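(* Let $n \geq 1$, $m \geq 1$ and $k \geq 2$ be integers, and let $w$ and $w'$ be $m$-weightings of the Sperner graph $B_n$ such that $w'$ is uniform on $\binom{[n]}{\lceil n/2 \rceil}$. Then $\pi_k(B_n(w')) \leq \pi_k(B_n(w))$.
   Context: All graphs are simple. $\mathbb{N}_0 = \{0,1,2,\dots\}$, $[n]=\{1,\dots,n\}$, and $\binom{X}{k}$ is the set of $k$-element subsets of $X$. For a graph $G$, a function $w: V(G) \to \mathbb{N}_0$ with $\sum_{v \in V(G)} w(v) = m$ is an $m$-weighting of $G$. $G(w)$ is the graph obtained from $G$ by replacing each vertex $v$ by a clique $K^v$ on $w(v)$ vertices and joining every vertex of $K^u$ to every vertex of $K^v$ whenever $uv \in E(G)$ (formally $V(G(w)) = \{(v,i): v\in V(G), i \in [w(v)]\}$, with $(u,i)(v,j)$ an edge iff $u=v$ and $i\neq j$, or $uv \in E(G)$). $\pi_k(H)$ denotes the number of $k$-cliques (complete subgraphs on $k$ vertices) of a graph $H$. For $U \subseteq V(G)$, an $m$-weighting $w$ is uniform on $U$ if $w(v)=0$ for all $v \notin U$ and $w(u) \in \{\lfloor m/|U|\rfloor, \lceil m/|U| \rceil\}$ for all $u \in U$. The Sperner graph $B_n$ has vertex set $2^{[n]}$ (all subsets of $[n]$) and edges $XY$ for all $X \subsetneq Y \subseteq [n]$. *)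

theory Defs
  imports Complex_Main "HOL-Library.Ramsey" "Graph_Theory.Kuratowski"
begin

text \<open>
  A simple graph is a \<^locale>\<open>pair_graph\<close>: a finite, loop-free, symmetric digraph without parallel
  arcs, where an undirected edge \<open>uv\<close> is represented by the two arcs \<open>(u, v)\<close> and \<open>(v, u)\<close>.
\<close>

definition sperner_graph :: "nat \<Rightarrow> nat set pair_pre_digraph" where
  "sperner_graph n =
     \<lparr> pverts = Pow {1..n},
       parcs = {(X, Y). X \<subseteq> {1..n} \<and> Y \<subseteq> {1..n} \<and> (X \<subset> Y \<or> Y \<subset> X)} \<rparr>"

text \<open>
  Only the values of a weighting on the vertices of the graph matter; its values elsewhere are
  arbitrary.
\<close>

definition weighting :: "'a pair_pre_digraph \<Rightarrow> nat \<Rightarrow> ('a \<Rightarrow> nat) \<Rightarrow> bool" where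
  "weighting G m w \<longleftrightarrow> (\<Sum>v\<in>pverts G. w v) = m"

definition blow_up :: "'a pair_pre_digraph \<Rightarrow> ('a \<Rightarrow> nat) \<Rightarrow> ('a \<times> nat) pair_pre_digraph" where
  "blow_up G w =
     \<lparr> pverts = (SIGMA v:pverts G. {1..w v}),
       parcs = {((u, i), (v, j)).
                  (u, i) \<in> (SIGMA v:pverts G. {1..w v}) \<and>
                  (v, j) \<in> (SIGMA v:pverts G. {1..w v}) \<and>
                  (u = v \<and> i \<noteq> j \<or> (u, v) \<in> parcs G)} \<rparr>"

definition num_cliques :: "nat \<Rightarrow> 'a pair_pre_digraph \<Rightarrow> nat" where
  "num_cliques k H =
     card {K :: 'a pair_pre_digraph.
             subgraph (with_proj K) (with_proj H) \<and> complete_digraph k (with_proj K)}"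

definition uniform_on :: "'a pair_pre_digraph \<Rightarrow> nat \<Rightarrow> ('a \<Rightarrow> nat) \<Rightarrow> 'a set \<Rightarrow> bool" where
  "uniform_on G m w U \<longleftrightarrow>
     (\<forall>v\<in>pverts G - U. w v = 0) \<and>
     (\<forall>u\<in>U. int (w u) \<in> {\<lfloor>real m / real (card U)\<rfloor>, \<lceil>real m / real (card U)\<rceil>})"

lemma pair_graph_sperner_graph: "pair_graph (sperner_graph n)"
proof -
  have "parcs (sperner_graph n) \<subseteq> Pow {1..n} \<times> Pow {1..n}"
    by (auto simp: sperner_graph_def)
  then have "finite (parcs (sperner_graph n))"
    by (rule finite_subset) simp
  then show ?thesis
    by unfold_locales (auto simp: sperner_graph_def symmetric_def intro!: symI)
qed

lemma pair_graph_blow_up: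
  assumes "pair_graph G"
  shows "pair_graph (blow_up G w)"
proof -
  interpret pair_graph G by fact
  let ?V = "SIGMA v:pverts G. {1..w v}"
  have fin: "finite ?V" by simp
  have "parcs (blow_up G w) \<subseteq> ?V \<times> ?V"
    by (auto simp: blow_up_def)
  then have "finite (parcs (blow_up G w))"
    by (rule finite_subset) (simp add: fin)
  moreover have "sym (parcs G)"
    using pair_sym_arcs by (simp add: symmetric_def)
  ultimately show ?thesis
    using fin
    by unfold_locales
       (auto simp: blow_up_def symmetric_def dest: symD no_loops' intro!: symI)
qed

text \<open>A clique is determined by its vertex set, so \<^const>\<open>num_cliques\<close> counts each one once.\<close>

lemma num_cliques_eq_card_vertex_sets:
  assumes "pair_graph H"
  shows "num_cliques k H =
    card {S \<in> nsets (pverts H) k. \<forall>u\<in>S. \<forall>v\<in>S. u \<noteq> v \<longrightarrow> (u, v) \<in> parcs H}"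
    (is "_ = card ?R")
proof -
  interpret pair_graph H by fact
  let ?L = "{K :: 'a pair_pre_digraph.
             subgraph (with_proj K) (with_proj H) \<and> complete_digraph k (with_proj K)}"
  have "inj_on pverts ?L"
    by (auto simp: inj_on_def complete_digraph_pair_def)
  then have "card (pverts ` ?L) = card ?L"
    by (rule card_image)
  moreover have "pverts ` ?L = ?R"
  proof (intro equalityI subsetI)
    fix S assume "S \<in> pverts ` ?L"
    then show "S \<in> ?R"
      by (auto simp: nsets_def complete_digraph_pair_def subgraph_def)
  next
    fix S assume S: "S \<in> ?R"
    let ?K = "\<lparr> pverts = S, parcs = {(u, v). (u, v) \<in> S \<times> S \<and> u \<noteq> v} \<rparr>"
    have "wf_digraph (with_proj ?K)"
      by unfold_locales auto
    then have "?K \<in> ?L"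
      using S wf_digraph
      by (auto simp: nsets_def complete_digraph_pair_def subgraph_def compatible_def)
    then show "S \<in> pverts ` ?L"
      by (rule rev_image_eqI) simp
  qed
  ultimately show ?thesis
    by (simp only: num_cliques_def)
qed

end

theory Submission
  imports Defs "HOL-Library.Disjoint_Sets"
begin

text \<open>
  Partition the Boolean lattice into symmetric chains (de Bruijn, Tengbergen and Kruyswijk); each
  chain meets the middle layer exactly once, so there are \<open>N = card (nsets {1..n} \<lceil>n/2\<rceil>)\<close> of them.
  Points of the blow-up lying over one chain form a clique, so the blow-up has at least
  \<open>\<Sum>\<^sub>C (w(C) choose k)\<close> cliques, where \<open>w(C)\<close> is the total weight of the chain \<open>C\<close>. Since
  \<open>x choose k\<close> is convex in \<open>x\<close> and the \<open>N\<close> weights \<open>w(C)\<close> sum to \<open>m\<close>, this is minimal when they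
  are as equal as possible. A uniform weighting of the middle layer, an antichain, attains that
  minimum.
\<close>

section \<open>Symmetric chains and their extension by a new element\<close>

text \<open>Prescribing the image of \<open>card\<close> makes the chain skip no level between
  \<open>r\<close> and \<open>n - r\<close>; \<open>2 * r \<le> n\<close> keeps this range, hence
  the chain, nonempty.\<close>

definition symmetric_chain :: "nat \<Rightarrow> nat set set \<Rightarrow> bool" where
  "symmetric_chain n C \<longleftrightarrow>
     C \<subseteq> Pow {1..n} \<and> chain_subset C \<and> (\<exists>r. 2 * r \<le> n \<and> card ` C = {r..n - r})"

text \<open>In a chain of finite sets, inclusion is decided by size. Hence \<open>card\<close> is
  injective on \<open>C\<close>, and the member of size \<open>n - r\<close> contains all others, so
  it equals the union.\<close>

lemma symmetric_chainE:
  assumes "symmetric_chain n C"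
  obtains r where "C \<subseteq> Pow {1..n}" "chain_subset C" "2 * r \<le> n" "card ` C = {r..n - r}"
    "inj_on card C" "\<Union>C \<in> C" "card (\<Union>C) = n - r"
proof -
  obtain r where r: "2 * r \<le> n" "card ` C = {r..n - r}"
    and sub: "C \<subseteq> Pow {1..n}" and chain: "chain_subset C"
    using assms by (auto simp: symmetric_chain_def)
  have fin: "finite X" if "X \<in> C" for X
    using that sub by (meson PowD finite_atLeastAtMost finite_subset subsetD)
  have le: "X \<subseteq> Y" if "X \<in> C" "Y \<in> C" "card X \<le> card Y" for X Y
    using that chain fin by (metis card_seteq chain_subset_def order_refl)
  have inj: "inj_on card C"
    by (intro inj_onI equalityI le) auto
  have "n - r \<in> card ` C"
    using r by auto
  then obtain T where T: "T \<in> C" "card T = n - r"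
    by auto
  have "X \<subseteq> T" if "X \<in> C" for X
  proof (rule le)
    have "card X \<in> {r..n - r}"
      using that r(2) by blast
    then show "card X \<le> card T"
      using T by simp
  qed (use that T in auto)
  then have "\<Union>C = T"
    using T(1) by blast
  then show thesis
    using that[OF sub chain r inj] T by simp
qed

text \<open>For a symmetric chain, \<open>\<Union>C\<close> is the top member. This chain and the
  next one are the two into which the inductive step splits \<open>C\<close> together with its copy
  shifted by \<open>Suc n\<close>: the shifted top moves over to the unshifted copy.\<close>

definition extended_chain :: "nat \<Rightarrow> nat set set \<Rightarrow> nat set set" where
  "extended_chain n C = insert (insert (Suc n) (\<Union>C)) C"

definition shifted_chain :: "nat \<Rightarrow> nat set set \<Rightarrow> nat set set" where
  "shifted_chain n C = insert (Suc n) ` (C - {\<Union>C})"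

lemma symmetric_chain_extended_chain:
  assumes "symmetric_chain n C"
  shows "symmetric_chain (Suc n) (extended_chain n C)"
proof -
  obtain r where r: "C \<subseteq> Pow {1..n}" "chain_subset C" "2 * r \<le> n" "card ` C = {r..n - r}"
    "\<Union>C \<in> C" "card (\<Union>C) = n - r"
    using assms by (rule symmetric_chainE)
  have top: "\<Union>C \<subseteq> {1..n}"
    using r(1) by blast
  then have "finite (\<Union>C)" "Suc n \<notin> \<Union>C"
    by (auto intro: finite_subset)
  then have "card (insert (Suc n) (\<Union>C)) = Suc (n - r)"
    using r(6) by simp
  then have "card ` extended_chain n C = insert (Suc (n - r)) {r..n - r}"
    using r(4) by (simp add: extended_chain_def)
  also have "\<dots> = {r..Suc n - r}"
    using r(3) by auto
  finally have "card ` extended_chain n C = {r..Suc n - r}" .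
  moreover have "extended_chain n C \<subseteq> Pow {1..Suc n}"
    using r(1) top by (force simp: extended_chain_def)
  moreover have "chain_subset (extended_chain n C)"
    using r(2) by (auto simp: extended_chain_def chain_subset_def)
  ultimately show ?thesis
    using r(3) by (auto simp: symmetric_chain_def intro!: exI[of _ r])
qed

lemma symmetric_chain_shifted_chain:
  assumes "symmetric_chain n C" and "shifted_chain n C \<noteq> {}"
  shows "symmetric_chain (Suc n) (shifted_chain n C)"
proof -
  obtain r where r: "C \<subseteq> Pow {1..n}" "chain_subset C" "2 * r \<le> n" "card ` C = {r..n - r}"
    "inj_on card C" "\<Union>C \<in> C" "card (\<Union>C) = n - r"
    using assms(1) by (rule symmetric_chainE)
  have card_insert: "card (insert (Suc n) X) = Suc (card X)" if "X \<in> C" for X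
  proof -
    have "X \<subseteq> {1..n}"
      using r(1) that by blast
    then have "finite X" "Suc n \<notin> X"
      by (auto intro: finite_subset)
    then show ?thesis
      by simp
  qed
  \<comment> \<open>Injectivity of \<open>card\<close> ensures that removing the top loses exactly
    the size \<open>n - r\<close>.\<close>
  have img: "card ` (C - {\<Union>C}) = {r..n - r} - {n - r}"
    using inj_on_image_set_diff[OF r(5), of C "{\<Union>C}"] r(4,6,7) by simp
  have "card ` shifted_chain n C = Suc ` card ` (C - {\<Union>C})"
    unfolding shifted_chain_def image_image by (intro image_cong) (auto simp: card_insert)
  also have "\<dots> = {Suc r..n - r}"
  proof -
    have "{r..n - r} - {n - r} = {r..<n - r}"
      by auto
    then show ?thesis
      unfolding img by (simp add: image_Suc_atLeastLessThan atLeastLessThanSuc_atLeastAtMost)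
  qed
  finally have eq: "card ` shifted_chain n C = {Suc r..Suc n - Suc r}"
    by simp
  \<comment> \<open>This gives \<open>2 * Suc r \<le> Suc n\<close>. It fails only if
    \<open>C\<close> is a single middle set, whose shifted chain is empty.\<close>
  then have "Suc r \<le> n - r"
    using assms(2) by (metis atLeastatMost_empty_iff2 diff_Suc_Suc image_is_empty)
  moreover have "shifted_chain n C \<subseteq> Pow {1..Suc n}"
    using r(1) by (force simp: shifted_chain_def)
  moreover have "chain_subset (shifted_chain n C)"
    using r(2) by (fastforce simp: shifted_chain_def chain_subset_def)
  ultimately show ?thesis
    using eq by (auto simp: symmetric_chain_def intro!: exI[of _ "Suc r"])
qed

section \<open>Decomposition of the Boolean lattice into symmetric chains\<close>

text \<open>Adding \<open>Suc n\<close> is injective on sets avoiding it, and the only set with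
  \<open>Suc n\<close> in the extended chain comes from the top, which the shifted chain
  omits.\<close>

lemma extended_chain_Int_shifted_chain:
  assumes "C \<subseteq> Pow {1..n}"
  shows "extended_chain n C \<inter> shifted_chain n C = {}"
proof -
  have "Suc n \<notin> X" if "X \<in> C" for X
    using assms that by fastforce
  then show ?thesis
    by (auto simp: extended_chain_def shifted_chain_def dest: insert_ident[THEN iffD1, rotated 2])
qed

lemma symmetric_chain_decomposition:
  "\<exists>D. partition_on (Pow {1..n}) D \<and> (\<forall>C\<in>D. symmetric_chain n C)"
proof (induction n)
  case 0
  have "symmetric_chain 0 {{}}"
    by (auto simp: symmetric_chain_def chain_subset_def)
  then show ?case
    by (intro exI[of _ "{{{}}}"]) (auto simp: partition_on_def)
next
  case (Suc n)
  then obtain D where part: "partition_on (Pow {1..n}) D"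
    and sym: "\<And>C. C \<in> D \<Longrightarrow> symmetric_chain n C"
    by auto
  have sub: "C \<subseteq> Pow {1..n}" and top: "\<Union>C \<in> C" if "C \<in> D" for C
    using sym[OF that] by (blast elim: symmetric_chainE)+
  have nin: "Suc n \<notin> X" if "X \<in> C" "C \<in> D" for X C
    using sub[OF that(2)] that(1) by fastforce
  \<comment> \<open>One-element chains have an empty shifted chain, which may not be a block of a
    partition.\<close>
  let ?D' = "extended_chain n ` D \<union> (shifted_chain n ` D - {{}})"
  \<comment> \<open>Deleting \<open>Suc n\<close> recovers a member of the parent chain, so new
    chains with different parents are disjoint.\<close>
  have restrict: "Z - {Suc n} \<in> C"
    if "C \<in> D" "Z \<in> extended_chain n C \<union> shifted_chain n C" for Z C
  proof -
    have "X - {Suc n} = X" if "X \<in> C" for X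
      using nin[OF that \<open>C \<in> D\<close>] by simp
    then show ?thesis
      using that top[OF that(1)] by (auto simp: extended_chain_def shifted_chain_def)
  qed
  have sym': "symmetric_chain (Suc n) C" if "C \<in> ?D'" for C
    using that
  proof
    assume "C \<in> extended_chain n ` D"
    then show ?thesis
      using sym symmetric_chain_extended_chain by blast
  next
    assume "C \<in> shifted_chain n ` D - {{}}"
    then show ?thesis
      using sym symmetric_chain_shifted_chain by blast
  qed
  have "partition_on (Pow {1..Suc n}) ?D'"
  proof (rule partition_onI)
    show "\<Union>?D' = Pow {1..Suc n}"
    proof (intro equalityI subsetI)
      fix Z assume "Z \<in> \<Union>?D'"
      then show "Z \<in> Pow {1..Suc n}"
        using sym' by (auto simp: symmetric_chain_def)
    next
      fix Z assume Z: "Z \<in> Pow {1..Suc n}"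
      then have "Z - {Suc n} \<in> Pow {1..n}"
        by (auto simp: atLeastAtMostSuc_conv)
      then obtain C where C: "C \<in> D" "Z - {Suc n} \<in> C"
        using part unfolding partition_on_def by blast
      have "Z \<in> extended_chain n C \<union> shifted_chain n C"
      proof (cases "Suc n \<in> Z")
        case True
        \<comment> \<open>\<open>Z\<close> lies in the extended chain if \<open>Z - {Suc n}\<close>
          is the top of \<open>C\<close>, and in the shifted chain otherwise.\<close>
        then have "Z = insert (Suc n) (Z - {Suc n})"
          by blast
        then show ?thesis
          using C(2) unfolding extended_chain_def shifted_chain_def by blast
      next
        case False
        then show ?thesis
          using C(2) by (simp add: extended_chain_def)
      qed
      then show "Z \<in> \<Union>?D'"
        using C(1) by blast
    qed
  next
    fix p q assume p: "p \<in> ?D'" and q: "q \<in> ?D'" and "p \<noteq> q"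
    obtain C where C: "C \<in> D" "p = extended_chain n C \<or> p = shifted_chain n C"
      using p by blast
    obtain C' where C': "C' \<in> D" "q = extended_chain n C' \<or> q = shifted_chain n C'"
      using q by blast
    show "disjnt p q"
    proof (cases "C = C'")
      case True
      then show ?thesis
        using C C' \<open>p \<noteq> q\<close> extended_chain_Int_shifted_chain[OF sub[OF C(1)]]
        by (auto simp: disjnt_def)
    next
      case False
      then have "C \<inter> C' = {}"
        using part C(1) C'(1) by (auto simp: partition_on_def disjoint_def)
      then show ?thesis
        using restrict[OF C(1)] restrict[OF C'(1)] C(2) C'(2) unfolding disjnt_def by blast
    qed
  next
    show "{} \<notin> ?D'"
      by (auto simp: extended_chain_def)
  qed
  then show ?case
    using sym' by blast
qed

text \<open>The bounds on \<open>h\<close> force it to be n/2 rounded up, a size occurring exactly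
  once in every symmetric chain. Sending a chain to its member of size \<open>h\<close> is therefore
  a bijection onto that layer.\<close>

lemma card_symmetric_chain_decomposition:
  assumes part: "partition_on (Pow {1..n}) D"
    and sym: "\<And>C. C \<in> D \<Longrightarrow> symmetric_chain n C"
    and h: "n \<le> 2 * h" "2 * h \<le> Suc n"
  shows "card D = card (nsets {1..n} h)"
proof -
  have "\<exists>X. X \<in> C \<and> card X = h" if C: "C \<in> D" for C
  proof -
    obtain r where "2 * r \<le> n" "card ` C = {r..n - r}"
      using sym[OF C] by (auto simp: symmetric_chain_def)
    \<comment> \<open>Adding \<open>2 * h \<le> Suc n\<close> and \<open>2 * r \<le> n\<close> gives
      \<open>2 * (h + r) \<le> 2 * n + 1\<close>, and parity then yields
      \<open>h + r \<le> n\<close>.\<close>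
    moreover have "h \<in> {r..n - r}"
      using h \<open>2 * r \<le> n\<close> by auto
    ultimately show ?thesis
      by (metis imageE)
  qed
  then obtain mid where mid: "\<And>C. C \<in> D \<Longrightarrow> mid C \<in> C \<and> card (mid C) = h"
    by metis
  have "bij_betw mid D (nsets {1..n} h)"
    unfolding bij_betw_def
  proof
    show "inj_on mid D"
    proof (rule inj_onI)
      fix C C' assume C: "C \<in> D" "C' \<in> D" "mid C = mid C'"
      then have "C \<inter> C' \<noteq> {}"
        using mid[of C] mid[of C'] by auto
      then show "C = C'"
        using C part unfolding partition_on_def disjoint_def by blast
    qed
    show "mid ` D = nsets {1..n} h"
    proof (intro equalityI subsetI)
      fix X assume "X \<in> mid ` D"
      then obtain C where "C \<in> D" "X = mid C"
        by blast
      then have "X \<subseteq> {1..n}" "card X = h"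
        using mid[of C] sym[of C] by (auto simp: symmetric_chain_def)
      then show "X \<in> nsets {1..n} h"
        by (auto simp: nsets_def intro: finite_subset)
    next
      fix X assume X: "X \<in> nsets {1..n} h"
      then have "X \<in> Pow {1..n}"
        by (simp add: nsets_def)
      then obtain C where C: "C \<in> D" "X \<in> C"
        using part unfolding partition_on_def by blast
      have "inj_on card C"
        using sym[OF C(1)] by (rule symmetric_chainE)
      then have "mid C = X"
        using mid[OF C(1)] C(2) X by (auto simp: nsets_def inj_on_def)
      then show "X \<in> mid ` D"
        using C(1) by blast
    qed
  qed
  then show ?thesis
    by (rule bij_betw_same_card)
qed

section \<open>Convexity of binomial coefficients and balanced sums\<close>

text \<open>Discrete convexity: by Pascal's rule the increment of \<open>x choose Suc j\<close> at
  \<open>x\<close> is \<open>x choose j\<close>, which is nondecreasing. The left side is the line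
  through the values at \<open>q\<close> and \<open>Suc q\<close>; integers are used because
  \<open>x\<close> may lie below \<open>q\<close>.\<close>

lemma binomial_tangent_le:
  "int (q choose Suc j) + (int x - int q) * int (q choose j) \<le> int (x choose Suc j)"
proof (cases "q \<le> x")
  case True
  then show ?thesis
  proof (induction x rule: dec_induct)
    case (step y)
    have "int (q choose j) \<le> int (y choose j)"
      using step by (simp add: binomial_right_mono)
    then show ?case
      using step.IH by (simp add: algebra_simps)
  qed simp
next
  case False
  then have "x \<le> q"
    by simp
  then show ?thesis
  proof (induction x rule: inc_induct)
    case (step y)
    have "int (y choose j) \<le> int (q choose j)"
      using step by (simp add: binomial_right_mono)
    then show ?case
      using step.IH by (simp add: algebra_simps)
  qed simp
qed

text \<open>The line of the previous lemma is exact at \<open>q\<close> and \<open>Suc q\<close>,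
  the only values of \<open>g\<close>, and is a lower bound at every value of
  \<open>f\<close>.\<close>

lemma sum_binomial_balanced_le:
  fixes f :: "'a \<Rightarrow> nat" and g :: "'b \<Rightarrow> nat"
  assumes "card A = card B" and "sum f A = sum g B" and "k \<ge> 1"
    and g: "\<And>b. b \<in> B \<Longrightarrow> g b = q \<or> g b = Suc q"
  shows "(\<Sum>b\<in>B. g b choose k) \<le> (\<Sum>a\<in>A. f a choose k)"
proof -
  obtain j where k: "k = Suc j"
    using \<open>k \<ge> 1\<close> by (cases k) auto
  let ?t = "\<lambda>x. int (q choose Suc j) + (int x - int q) * int (q choose j)"
  have "int (\<Sum>b\<in>B. g b choose k) = (\<Sum>b\<in>B. ?t (g b))"
    unfolding of_nat_sum
  proof (rule sum.cong)
    fix b assume "b \<in> B"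
    then show "int (g b choose k) = ?t (g b)"
      using g[of b] k by auto
  qed simp
  \<comment> \<open>A sum of affine terms depends only on the number of terms and their total, which
    agree for \<open>f\<close> and \<open>g\<close>.\<close>
  also have "\<dots> = (\<Sum>a\<in>A. ?t (f a))"
    by (simp add: sum.distrib sum_subtractf assms(1) flip: sum_distrib_right of_nat_sum assms(2))
  also have "\<dots> \<le> int (\<Sum>a\<in>A. f a choose k)"
    unfolding of_nat_sum k by (intro sum_mono binomial_tangent_le)
  finally show ?thesis
    by (simp only: of_nat_le_iff)
qed

text \<open>Brings uniformity into the form required of \<open>g\<close> above, with
  \<open>q = m div card U\<close>.\<close>

lemma uniform_on_cases:
  assumes "uniform_on G m w U" and "u \<in> U"
  shows "w u = m div card U \<or> w u = Suc (m div card U)"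
proof -
  have "\<lfloor>real m / real (card U)\<rfloor> = int (m div card U)"
    by (rule floor_divide_of_nat_eq)
  moreover have "\<lceil>real m / real (card U)\<rceil> \<le> \<lfloor>real m / real (card U)\<rfloor> + 1"
    "\<lfloor>real m / real (card U)\<rfloor> \<le> \<lceil>real m / real (card U)\<rceil>"
    by linarith+
  moreover have "int (w u) \<in> {\<lfloor>real m / real (card U)\<rfloor>, \<lceil>real m / real (card U)\<rceil>}"
    using assms by (auto simp: uniform_on_def)
  ultimately show ?thesis
    by auto
qed

section \<open>Clique counts in blow-ups\<close>

text \<open>The index condition in the blow-up disappears: distinct points over the same vertex
  automatically have different indices.\<close>

lemma num_cliques_blow_up:
  assumes "pair_graph G"
  shows "num_cliques k (blow_up G w) =
    card {S \<in> nsets (SIGMA v:pverts G. {1..w v}) k.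
            \<forall>u\<in>S. \<forall>v\<in>S. u \<noteq> v \<longrightarrow> fst u = fst v \<or> (fst u, fst v) \<in> parcs G}"
proof -
  let ?V = "SIGMA v:pverts G. {1..w v}"
  have verts: "pverts (blow_up G w) = ?V"
    by (simp add: blow_up_def)
  have arcs: "(p, q) \<in> parcs (blow_up G w) \<longleftrightarrow> fst p = fst q \<or> (fst p, fst q) \<in> parcs G"
    if "p \<in> ?V" "q \<in> ?V" "p \<noteq> q" for p q
    using that by (auto simp: blow_up_def)
  show ?thesis
    unfolding num_cliques_eq_card_vertex_sets[OF pair_graph_blow_up[OF assms]] verts
  proof (intro arg_cong[of _ _ card] Collect_cong conj_cong refl ball_cong imp_cong)
    fix S p q assume "S \<in> nsets ?V k" "p \<in> S" "q \<in> S" "p \<noteq> q"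
    then show "(p, q) \<in> parcs (blow_up G w) \<longleftrightarrow> fst p = fst q \<or> (fst p, fst q) \<in> parcs G"
      by (intro arcs) (auto simp: nsets_def)
  qed
qed

text \<open>All points lie over the independent set \<open>U\<close>, so no clique can meet two
  fibres; each lies in a single fibre \<open>{u} \<times> {1..w u}\<close>.\<close>

lemma num_cliques_blow_up_independent_le:
  assumes "pair_graph G" and "U \<subseteq> pverts G" and "k \<ge> 1"
    and zero: "\<And>v. v \<in> pverts G - U \<Longrightarrow> w v = 0"
    and indep: "\<And>u v. u \<in> U \<Longrightarrow> v \<in> U \<Longrightarrow> (u, v) \<notin> parcs G"
  shows "num_cliques k (blow_up G w) \<le> (\<Sum>u\<in>U. w u choose k)"
proof -
  interpret pair_graph G by fact
  have fin: "finite U"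
    using \<open>U \<subseteq> pverts G\<close> by (rule finite_subset) simp
  let ?S = "{S \<in> nsets (SIGMA v:pverts G. {1..w v}) k.
            \<forall>u\<in>S. \<forall>v\<in>S. u \<noteq> v \<longrightarrow> fst u = fst v \<or> (fst u, fst v) \<in> parcs G}"
  have "?S \<subseteq> (\<Union>u\<in>U. nsets ({u} \<times> {1..w u}) k)"
  proof
    fix S assume S: "S \<in> ?S"
    have U: "fst p \<in> U" if "p \<in> S" for p
    proof -
      have "fst p \<in> pverts G" "w (fst p) \<noteq> 0"
        using S that by (auto simp: nsets_def)
      then show ?thesis
        using zero[of "fst p"] by auto
    qed
    have "S \<noteq> {}"
      using S \<open>k \<ge> 1\<close> by (auto simp: nsets_def)
    then obtain p where p: "p \<in> S"
      by blast
    have "fst q = fst p" if "q \<in> S" for q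
      using S p that indep[OF U[OF that] U[OF p]] by auto
    then have "S \<in> nsets ({fst p} \<times> {1..w (fst p)}) k"
      using S by (fastforce simp: nsets_def)
    then show "S \<in> (\<Union>u\<in>U. nsets ({u} \<times> {1..w u}) k)"
      using U[OF p] by blast
  qed
  moreover have "finite (\<Union>u\<in>U. nsets ({u} \<times> {1..w u}) k)"
    using fin by (auto intro!: finite_imp_finite_nsets)
  ultimately have "card ?S \<le> card (\<Union>u\<in>U. nsets ({u} \<times> {1..w u}) k)"
    by (rule card_mono[rotated])
  also have "\<dots> \<le> (\<Sum>u\<in>U. card (nsets ({u} \<times> {1..w u}) k))"
    by (rule card_UN_le[OF fin])
  finally show ?thesis
    by (simp add: num_cliques_blow_up[OF assms(1)] card_cartesian_product)
qed

text \<open>The part of the blow-up over a block \<open>C\<close> is a clique on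
  \<open>sum w C\<close> points, so each of its \<open>k\<close>-subsets counts.\<close>

lemma num_cliques_blow_up_clique_partition_ge:
  assumes "pair_graph G" and part: "partition_on (pverts G) D" and "k \<ge> 1"
    and clique: "\<And>C u v. C \<in> D \<Longrightarrow> u \<in> C \<Longrightarrow> v \<in> C \<Longrightarrow> u \<noteq> v \<Longrightarrow> (u, v) \<in> parcs G"
  shows "(\<Sum>C\<in>D. sum w C choose k) \<le> num_cliques k (blow_up G w)"
proof -
  interpret pair_graph G by fact
  have fin: "finite D"
    using part by (rule finite_elements[rotated]) simp
  have sub: "C \<subseteq> pverts G" if "C \<in> D" for C
    using that part by (auto simp: partition_on_def)
  have finC: "finite C" if "C \<in> D" for C
    using sub[OF that] by (rule finite_subset) simp
  let ?N = "\<lambda>C. nsets (SIGMA v:C. {1..w v}) k"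
  let ?S = "{S \<in> nsets (SIGMA v:pverts G. {1..w v}) k.
            \<forall>u\<in>S. \<forall>v\<in>S. u \<noteq> v \<longrightarrow> fst u = fst v \<or> (fst u, fst v) \<in> parcs G}"
  have "(\<Sum>C\<in>D. sum w C choose k) = (\<Sum>C\<in>D. card (?N C))"
    using finC by (intro sum.cong) auto
  also have "\<dots> = card (\<Union>C\<in>D. ?N C)"
  proof (rule card_UN_disjoint[symmetric])
    show "\<forall>C\<in>D. finite (?N C)"
      using finC by (auto intro!: finite_imp_finite_nsets)
    \<comment> \<open>Since \<open>k \<ge> 1\<close>, a counted set has a point, and its first
      component determines the block.\<close>
    show "\<forall>C\<in>D. \<forall>C'\<in>D. C \<noteq> C' \<longrightarrow> ?N C \<inter> ?N C' = {}"
    proof (intro ballI impI, rule ccontr)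
      fix C C' assume C: "C \<in> D" "C' \<in> D" "C \<noteq> C'" "?N C \<inter> ?N C' \<noteq> {}"
      then obtain S where S: "S \<in> ?N C" "S \<in> ?N C'"
        by blast
      then have "S \<noteq> {}"
        using \<open>k \<ge> 1\<close> by (auto simp: nsets_def)
      then obtain p where "p \<in> S"
        by blast
      then have "fst p \<in> C \<inter> C'"
        using S by (auto simp: nsets_def)
      then show False
        using C part by (auto simp: partition_on_def disjoint_def)
    qed
  qed (fact fin)
  also have "\<dots> \<le> card ?S"
  proof (rule card_mono)
    show "finite ?S"
      by (rule finite_subset[OF _ finite_imp_finite_nsets[of "SIGMA v:pverts G. {1..w v}" k]]) auto
    show "(\<Union>C\<in>D. ?N C) \<subseteq> ?S"
    proof
      fix S assume "S \<in> (\<Union>C\<in>D. ?N C)"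
      then obtain C where C: "C \<in> D" "S \<in> ?N C"
        by blast
      then have "fst p \<in> C" if "p \<in> S" for p
        using that by (auto simp: nsets_def)
      moreover have "S \<in> nsets (SIGMA v:pverts G. {1..w v}) k"
        using C sub[OF C(1)] by (fastforce simp: nsets_def)
      ultimately show "S \<in> ?S"
        using clique[OF C(1)] by blast
    qed
  qed
  finally show ?thesis
    by (simp add: num_cliques_blow_up[OF assms(1)])
qed

section \<open>Comparison of a weighting with the uniform one on the middle layer\<close>

theorem theorem5:
  fixes n m k :: nat and w w' :: "nat set \<Rightarrow> nat"
  assumes "n \<ge> 1" and "m \<ge> 1" and "k \<ge> 2"
    and "weighting (sperner_graph n) m w"
    and "weighting (sperner_graph n) m w'"
    and "uniform_on (sperner_graph n) m w' (nsets {1..n} (nat \<lceil>real n / 2\<rceil>))"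
  shows "num_cliques k (blow_up (sperner_graph n) w') \<le> num_cliques k (blow_up (sperner_graph n) w)"
proof -
  let ?G = "sperner_graph n"
  define h where "h = nat \<lceil>real n / 2\<rceil>"
  define U where "U = nsets {1..n} h"
  have h: "n \<le> 2 * h" "2 * h \<le> Suc n"
    unfolding h_def by linarith+
  have verts: "pverts ?G = Pow {1..n}"
    by (simp add: sperner_graph_def)
  have unif: "uniform_on ?G m w' U"
    using assms(6) by (simp add: U_def h_def)
  have U: "U \<subseteq> pverts ?G"
    by (auto simp: U_def nsets_def verts)
  have zero: "w' v = 0" if "v \<in> pverts ?G - U" for v
    using unif that by (auto simp: uniform_on_def)
  obtain D where part: "partition_on (Pow {1..n}) D"
    and sym: "\<And>C. C \<in> D \<Longrightarrow> symmetric_chain n C"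
    using symmetric_chain_decomposition[of n] by auto
  have "(\<Sum>C\<in>D. sum w C) = sum w (\<Union>D)"
    by (rule sum.Union_disjoint_sets[symmetric, simplified comp_def])
      (use part in \<open>auto simp: partition_on_def disjoint_def intro: finite_subset\<close>)
  also have "\<dots> = m"
    using assms(4) part by (simp add: weighting_def verts partition_on_def)
  \<comment> \<open>As \<open>w'\<close> vanishes off \<open>U\<close>, the middle layer carries its
    whole weight.\<close>
  also have "m = sum w' U"
    using assms(5) sum.mono_neutral_right[OF _ U, of w'] zero by (simp add: weighting_def verts)
  finally have sums: "(\<Sum>C\<in>D. sum w C) = sum w' U" .
  have "num_cliques k (blow_up ?G w') \<le> (\<Sum>u\<in>U. w' u choose k)"
  proof (rule num_cliques_blow_up_independent_le[OF pair_graph_sperner_graph U _ zero])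
    fix u v assume "u \<in> U" "v \<in> U"
    \<comment> \<open>Finite sets of equal size cannot be properly nested.\<close>
    then have "\<not> u \<subset> v" "\<not> v \<subset> u"
      using psubset_card_mono[of u v] psubset_card_mono[of v u] by (auto simp: U_def nsets_def)
    then show "(u, v) \<notin> parcs ?G"
      by (simp add: sperner_graph_def)
  qed (use \<open>k \<ge> 2\<close> in auto)
  also have "\<dots> \<le> (\<Sum>C\<in>D. sum w C choose k)"
    \<comment> \<open>The chain weights play the role of \<open>f\<close> and the values of
      \<open>w'\<close> on \<open>U\<close> that of \<open>g\<close>; there are equally many of
      each, with the same total.\<close>
    using card_symmetric_chain_decomposition[OF part sym h] sums \<open>k \<ge> 2\<close> uniform_on_cases[OF unif]
    by (intro sum_binomial_balanced_le) (auto simp: U_def)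
  also have "\<dots> \<le> num_cliques k (blow_up ?G w)"
  proof (rule num_cliques_blow_up_clique_partition_ge[OF pair_graph_sperner_graph])
    fix C u v assume "C \<in> D" "u \<in> C" "v \<in> C" "u \<noteq> v"
    then have "u \<subset> v \<or> v \<subset> u" "u \<subseteq> {1..n}" "v \<subseteq> {1..n}"
      using sym[of C] unfolding symmetric_chain_def chain_subset_def psubset_eq by blast+
    then show "(u, v) \<in> parcs ?G"
      by (simp add: sperner_graph_def)
  qed (use part \<open>k \<ge> 2\<close> verts in auto)
  finally show ?thesis .
qed

end
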